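(* Let $\xi\in\mathbb C/2\mathbb Z$ and $\tau\in\mathbb C$ be such that $\tau\ne(\mu+1)^2$ for all $\mu\in\xi$. For every object $M$ of $\bar{\mathfrak M}^{\xi,\tau}$ and any square root $\sqrt c$ of its Casimir operator $c$ (that is, any $\mathfrak{sl}(2)$-module endomorphism of $M$ whose square is the action of $c$ on $M$), there exists a compatible structure of $\mathbf{Witt}_{>}$-module on $M$ such that $c$ is central, i.e. $c$ commutes with the operator representing $L_i$ for every $i\ge-1$.
   Context: $\mathfrak{sl}(2)=\mathfrak{sl}(2,\mathbb C)$ has Chevalley basis $\{e,f,h\}$ with $[e,f]=h$, $[h,e]=2e$, $[h,f]=-2f$. $\mathbf{Witt}_{>}$ is the complex Lie algebra with basis $\{L_k\}_{k\ge-1}$ and bracket $[L_i,L_j]=(i-j)L_{i+j}$; $\mathfrak{sl}(2)$ is embedded in it by $f\mapsto L_{-1}$, $h\mapsto-2L_0$, $e\mapsto-L_1$, and a $\mathbf{Witt}_{>}$-module structure on an $\mathfrak{sl}(2)$-module is compatible if its restriction along this embedding is the given $\mathfrak{sl}(2)$-structure. The Casimir operator is $c=(h+1)^2+4fe$. For an $\mathfrak{sl}(2)$-module $M$ and $\lambda\in\mathbb C$, $M_\lambda=\{m\in M: hm=\lambda m\}$; $M$ is a weight module if $M=\bigoplus_\lambda M_\lambda$, and $\operatorname{supp}(M)=\{\lambda: M_\lambda\neq0\}$. A class $\xi\in\mathbb C/2\mathbb Z$ is regarded as a subset of $\mathbb C$. $\bar{\mathfrak M}^{\xi,\tau}$ is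 the full subcategory of $\mathfrak{sl}(2)$-modules whose objects are the weight modules $M$ with finite-dimensional weight spaces, $\operatorname{supp}(M)\subseteq\xi$, and such that $(c-\tau)|_{M_\lambda}$ is nilpotent for every $\lambda\in\xi$. *)

theory Defs
  imports "HOL-Analysis.Analysis" "HOL-Computational_Algebra.Polynomial"
begin

section \<open>Complex Lie algebras and their modules\<close>

text \<open>A Lie algebra is carried by a linear subspace \<open>\<gg>\<close> of a complex vector space;
  the bracket is only constrained on \<open>\<gg>\<close>.\<close>

locale lie_algebra =
  G: vector_space scaleG
  for scaleG :: "complex \<Rightarrow> 'g::ab_group_add \<Rightarrow> 'g"
    and \<gg> :: "'g set"
    and bracket :: "'g \<Rightarrow> 'g \<Rightarrow> 'g" +
  assumes subspace_carrier: "G.subspace \<gg>"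
    and bracket_closed: "x \<in> \<gg> \<Longrightarrow> y \<in> \<gg> \<Longrightarrow> bracket x y \<in> \<gg>"
    and bracket_add_left:
      "x \<in> \<gg> \<Longrightarrow> y \<in> \<gg> \<Longrightarrow> z \<in> \<gg> \<Longrightarrow> bracket (x + y) z = bracket x z + bracket y z"
    and bracket_add_right:
      "x \<in> \<gg> \<Longrightarrow> y \<in> \<gg> \<Longrightarrow> z \<in> \<gg> \<Longrightarrow> bracket x (y + z) = bracket x y + bracket x z"
    and bracket_scale_left:
      "x \<in> \<gg> \<Longrightarrow> y \<in> \<gg> \<Longrightarrow> bracket (scaleG a x) y = scaleG a (bracket x y)"
    and bracket_scale_right:
      "x \<in> \<gg> \<Longrightarrow> y \<in> \<gg> \<Longrightarrow> bracket x (scaleG a y) = scaleG a (bracket x y)"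
    and bracket_self: "x \<in> \<gg> \<Longrightarrow> bracket x x = 0"
    and jacobi:
      "x \<in> \<gg> \<Longrightarrow> y \<in> \<gg> \<Longrightarrow> z \<in> \<gg> \<Longrightarrow>
        bracket x (bracket y z) + bracket y (bracket z x) + bracket z (bracket x y) = 0"

locale lie_module =
  lie_algebra scaleG \<gg> bracket + V: vector_space scaleV
  for scaleG :: "complex \<Rightarrow> 'g::ab_group_add \<Rightarrow> 'g"
    and \<gg> :: "'g set"
    and bracket :: "'g \<Rightarrow> 'g \<Rightarrow> 'g"
    and scaleV :: "complex \<Rightarrow> 'v::ab_group_add \<Rightarrow> 'v"
    and act :: "'g \<Rightarrow> 'v \<Rightarrow> 'v" +
  assumes act_linear: "x \<in> \<gg> \<Longrightarrow> Vector_Spaces.linear scaleV scaleV (act x)"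
    and act_add: "x \<in> \<gg> \<Longrightarrow> y \<in> \<gg> \<Longrightarrow> act (x + y) v = act x v + act y v"
    and act_scale: "x \<in> \<gg> \<Longrightarrow> act (scaleG a x) v = scaleV a (act x v)"
    and act_bracket:
      "x \<in> \<gg> \<Longrightarrow> y \<in> \<gg> \<Longrightarrow> act (bracket x y) v = act x (act y v) - act y (act x v)"

section \<open>The Lie algebra \<open>\<ss>\<ll>(2)\<close>\<close>

type_synonym cmat2 = "complex^2^2"

definition sl2 :: "cmat2 set" where
  "sl2 = {A. trace A = 0}"

definition mat_scale :: "complex \<Rightarrow> cmat2 \<Rightarrow> cmat2" where
  "mat_scale a A = (\<chi> i j. a * A $ i $ j)"

definition commutator :: "cmat2 \<Rightarrow> cmat2 \<Rightarrow> cmat2" where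
  "commutator A B = A ** B - B ** A"

definition sl2_e :: cmat2 where
  "sl2_e = vector [vector [0, 1], vector [0, 0]]"

definition sl2_f :: cmat2 where
  "sl2_f = vector [vector [0, 0], vector [1, 0]]"

definition sl2_h :: cmat2 where
  "sl2_h = vector [vector [1, 0], vector [0, -1]]"

lemmas sl2_defs = sl2_def mat_scale_def commutator_def sl2_e_def sl2_f_def sl2_h_def
  trace_def matrix_matrix_mult_def vec_eq_iff sum_2 forall_2

interpretation mat_scale: vector_space mat_scale
  by unfold_locales (simp_all add: mat_scale_def vec_eq_iff algebra_simps)

interpretation sl2: lie_algebra mat_scale sl2 commutator
proof unfold_locales
  show "mat_scale.subspace sl2"
    unfolding mat_scale.subspace_def by (auto simp: sl2_defs algebra_simps) (metis distrib_left mult_zero_right)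
qed (auto simp add: sl2_defs algebra_simps)

lemma sl2_mem: "sl2_e \<in> sl2" "sl2_f \<in> sl2" "sl2_h \<in> sl2"
  by (simp_all add: sl2_defs)

lemma sl2_brackets:
  "commutator sl2_e sl2_f = sl2_h"
  "commutator sl2_h sl2_e = mat_scale 2 sl2_e"
  "commutator sl2_h sl2_f = mat_scale (-2) sl2_f"
  by (simp_all add: sl2_defs)

lemma sl2_coordinates:
  assumes "A \<in> sl2"
  shows "A = mat_scale (A $ 1 $ 2) sl2_e + mat_scale (A $ 2 $ 1) sl2_f + mat_scale (A $ 1 $ 1) sl2_h"
  using assms by (simp add: sl2_defs eq_neg_iff_add_eq_0 add.commute)

section \<open>The Lie algebra \<open>Witt\<^sub>>\<close>\<close>

text \<open>The underlying vector space is \<open>\<complex>[X]\<close>, with \<open>X ^ (k + 1)\<close> as the basis vector \<open>L\<^sub>k\<close>,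
  \<open>k \<ge> -1\<close>; the polynomial \<open>p\<close> stands for the vector field \<open>- p d/dX\<close>.
  The value of \<open>witt_L k\<close> for \<open>k < -1\<close> is junk.\<close>

definition witt_L :: "int \<Rightarrow> complex poly" where
  "witt_L k = monom 1 (nat (k + 1))"

definition witt_bracket :: "complex poly \<Rightarrow> complex poly \<Rightarrow> complex poly" where
  "witt_bracket p q = pderiv p * q - p * pderiv q"

interpretation smult: vector_space "smult :: complex \<Rightarrow> complex poly \<Rightarrow> complex poly"
  by unfold_locales (simp_all add: smult_add_right smult_add_left)

interpretation witt: lie_algebra smult UNIV witt_bracket
  by unfold_locales
    (simp_all add: witt_bracket_def pderiv_add pderiv_diff pderiv_mult pderiv_smult algebra_simps
      smult_diff_right)

lemma witt_bracket_L:
  assumes "i \<ge> -1" "j \<ge> -1"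
  shows "witt_bracket (witt_L i) (witt_L j) = smult (of_int (i - j)) (witt_L (i + j))"
proof -
  define m where "m = nat (i + 1)"
  define n where "n = nat (j + 1)"
  have L: "witt_L i = monom 1 m" "witt_L j = monom 1 n" "witt_L (i + j) = monom 1 (m + n - 1)"
    and ij: "i - j = int m - int n"
    using assms by (auto simp: witt_L_def m_def n_def nat_add_distrib intro!: arg_cong[of _ _ "monom 1"])
  show ?thesis
    unfolding witt_bracket_def L ij
    by (cases m; cases n) (auto simp: pderiv_monom mult_monom smult_monom diff_monom minus_monom)
qed

lemma witt_L_basis:
  "inj_on witt_L {-1..}"
  "smult.independent (witt_L ` {-1..})"
  "smult.span (witt_L ` {-1..}) = UNIV"
proof -
  show inj: "inj_on witt_L {-1..}"
    by (auto simp: inj_on_def witt_L_def monom_eq_iff')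
  have range: "witt_L ` {-1..} = range (monom 1)"
  proof -
    have "monom 1 n = witt_L (int n - 1)" "int n - 1 \<in> {-1..}" for n
      by (auto simp: witt_L_def)
    then have "range (monom 1) \<subseteq> witt_L ` {-1..}"
      by blast
    then show ?thesis
      by (auto simp: witt_L_def)
  qed
  show "smult.independent (witt_L ` {-1..})"
    unfolding range smult.independent_explicit_module
  proof (intro allI impI)
    fix t :: "complex poly set" and u v
    assume t: "finite t" "t \<subseteq> range (monom 1)" "(\<Sum>w\<in>t. smult (u w) w) = 0" "v \<in> t"
    from t obtain n where v: "v = monom 1 n" by blast
    have "0 = (\<Sum>w\<in>t. coeff (smult (u w) w) n)"
      using t(3) by (metis coeff_0 coeff_sum)
    also have "\<dots> = (\<Sum>w\<in>t. if w = v then u v else 0)"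
    proof (rule sum.cong)
      fix w assume "w \<in> t"
      then obtain k where "w = monom 1 k"
        using t(2) by blast
      then show "coeff (smult (u w) w) n = (if w = v then u v else 0)"
        by (auto simp: v monom_eq_iff')
    qed simp
    finally show "u v = 0"
      using t by simp
  qed
  have "p \<in> smult.span (range (monom 1))" for p :: "complex poly"
  proof -
    have "p = (\<Sum>i\<le>degree p. smult (coeff p i) (monom 1 i))"
      by (simp add: smult_monom poly_as_sum_of_monoms)
    also have "\<dots> \<in> smult.span (range (monom 1))"
      by (intro smult.span_sum smult.span_scale smult.span_base) auto
    finally show ?thesis .
  qed
  then show "smult.span (witt_L ` {-1..}) = UNIV"
    unfolding range by blast
qed

section \<open>The embedding and compatible structures\<close>

definition sl2_to_witt :: "cmat2 \<Rightarrow> complex poly" where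
  "sl2_to_witt A =
     smult (A $ 2 $ 1) (witt_L (-1)) + smult (A $ 1 $ 1) (smult (-2) (witt_L 0))
       + smult (A $ 1 $ 2) (- witt_L 1)"

lemma sl2_to_witt_basis:
  "sl2_to_witt sl2_f = witt_L (-1)"
  "sl2_to_witt sl2_h = smult (-2) (witt_L 0)"
  "sl2_to_witt sl2_e = - witt_L 1"
  by (simp_all add: sl2_to_witt_def sl2_defs)

lemma sl2_to_witt_hom:
  "sl2_to_witt (A + B) = sl2_to_witt A + sl2_to_witt B"
  "sl2_to_witt (mat_scale a A) = smult a (sl2_to_witt A)"
  "A \<in> sl2 \<Longrightarrow> B \<in> sl2 \<Longrightarrow>
     sl2_to_witt (commutator A B) = witt_bracket (sl2_to_witt A) (sl2_to_witt B)"
  "inj_on sl2_to_witt sl2"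
proof -
  have eq: "sl2_to_witt A = [:A $ 2 $ 1, -2 * A $ 1 $ 1, - (A $ 1 $ 2):]" for A
    by (simp add: sl2_to_witt_def witt_L_def monom_0 monom_Suc numeral_2_eq_2)
  show "sl2_to_witt (A + B) = sl2_to_witt A + sl2_to_witt B"
    by (simp add: eq)
  show "sl2_to_witt (mat_scale a A) = smult a (sl2_to_witt A)"
    by (simp add: eq mat_scale_def)
  show "sl2_to_witt (commutator A B) = witt_bracket (sl2_to_witt A) (sl2_to_witt B)"
    if "A \<in> sl2" "B \<in> sl2"
  proof -
    have "A $ 2 $ 2 = - A $ 1 $ 1" "B $ 2 $ 2 = - B $ 1 $ 1"
      using that by (simp_all add: sl2_defs eq_neg_iff_add_eq_0 add.commute)
    then show ?thesis
      by (simp add: eq witt_bracket_def commutator_def matrix_matrix_mult_def sum_2 pderiv_pCons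
          algebra_simps)
  qed
  show "inj_on sl2_to_witt sl2"
    by (rule inj_onI) (simp add: eq sl2_defs, metis add_left_cancel)
qed

abbreviation sl2_module ::
    "(complex \<Rightarrow> 'v::ab_group_add \<Rightarrow> 'v) \<Rightarrow> (cmat2 \<Rightarrow> 'v \<Rightarrow> 'v) \<Rightarrow> bool" where
  "sl2_module \<equiv> lie_module mat_scale sl2 commutator"

abbreviation witt_module ::
    "(complex \<Rightarrow> 'v::ab_group_add \<Rightarrow> 'v) \<Rightarrow> (complex poly \<Rightarrow> 'v \<Rightarrow> 'v) \<Rightarrow> bool" where
  "witt_module \<equiv> lie_module smult UNIV witt_bracket"

definition compatible :: "(cmat2 \<Rightarrow> 'v \<Rightarrow> 'v) \<Rightarrow> (complex poly \<Rightarrow> 'v \<Rightarrow> 'v) \<Rightarrow> bool" where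
  "compatible act W \<longleftrightarrow> (\<forall>A\<in>sl2. \<forall>v. W (sl2_to_witt A) v = act A v)"

section \<open>Weight modules\<close>

definition casimir ::
    "(complex \<Rightarrow> 'v::ab_group_add \<Rightarrow> 'v) \<Rightarrow> (cmat2 \<Rightarrow> 'v \<Rightarrow> 'v) \<Rightarrow> 'v \<Rightarrow> 'v" where
  "casimir scaleV act v =
     (let h1 = (\<lambda>w. act sl2_h w + w) in h1 (h1 v) + scaleV 4 (act sl2_f (act sl2_e v)))"

definition sl2_endomorphism ::
    "(complex \<Rightarrow> 'v::ab_group_add \<Rightarrow> 'v) \<Rightarrow> (cmat2 \<Rightarrow> 'v \<Rightarrow> 'v) \<Rightarrow> ('v \<Rightarrow> 'v) \<Rightarrow> bool" where
  "sl2_endomorphism scaleV act s \<longleftrightarrow>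
     Vector_Spaces.linear scaleV scaleV s \<and> (\<forall>A\<in>sl2. \<forall>v. s (act A v) = act A (s v))"

definition weight_space ::
    "(complex \<Rightarrow> 'v::ab_group_add \<Rightarrow> 'v) \<Rightarrow> (cmat2 \<Rightarrow> 'v \<Rightarrow> 'v) \<Rightarrow> complex \<Rightarrow> 'v set" where
  "weight_space scaleV act \<mu> = {v. act sl2_h v = scaleV \<mu> v}"

definition supp ::
    "(complex \<Rightarrow> 'v::ab_group_add \<Rightarrow> 'v) \<Rightarrow> (cmat2 \<Rightarrow> 'v \<Rightarrow> 'v) \<Rightarrow> complex set" where
  "supp scaleV act = {\<mu>. weight_space scaleV act \<mu> \<noteq> {0}}"

text \<open>The module is the direct sum of its weight spaces: every vector has exactly one
  finitely supported decomposition into weight vectors.\<close>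

definition weight_module ::
    "(complex \<Rightarrow> 'v::ab_group_add \<Rightarrow> 'v) \<Rightarrow> (cmat2 \<Rightarrow> 'v \<Rightarrow> 'v) \<Rightarrow> bool" where
  "weight_module scaleV act \<longleftrightarrow>
     sl2_module scaleV act \<and>
     (\<forall>v. \<exists>!c. finite {\<mu>. c \<mu> \<noteq> 0} \<and> (\<forall>\<mu>. c \<mu> \<in> weight_space scaleV act \<mu>) \<and>
        v = (\<Sum>\<mu> | c \<mu> \<noteq> 0. c \<mu>))"

definition finite_dimensional ::
    "(complex \<Rightarrow> 'v::ab_group_add \<Rightarrow> 'v) \<Rightarrow> 'v set \<Rightarrow> bool" where
  "finite_dimensional scaleV U \<longleftrightarrow> (\<exists>B. finite B \<and> U = module.span scaleV B)"

definition cong_mod_2Z :: "complex rel" where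
  "cong_mod_2Z = {(x, y). \<exists>n::int. x - y = 2 * of_int n}"

definition object_M_bar ::
    "complex set \<Rightarrow> complex \<Rightarrow> (complex \<Rightarrow> 'v::ab_group_add \<Rightarrow> 'v) \<Rightarrow> (cmat2 \<Rightarrow> 'v \<Rightarrow> 'v) \<Rightarrow> bool"
  where
  "object_M_bar \<xi> \<tau> scaleV act \<longleftrightarrow>
     weight_module scaleV act \<and>
     (\<forall>\<mu>. finite_dimensional scaleV (weight_space scaleV act \<mu>)) \<and>
     supp scaleV act \<subseteq> \<xi> \<and>
     (\<forall>\<mu>\<in>\<xi>. \<exists>n. \<forall>v\<in>weight_space scaleV act \<mu>.
        ((\<lambda>w. casimir scaleV act w - scaleV \<tau> w) ^^ n) v = 0)"

end

theory Submission
  imports Defs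
begin

text \<open>
  The Witt action is modelled on tensor densities of weight \<open>\<lambda>\<close> on the line: the vector field
  \<open>- p d/dX\<close> acts on them by \<open>p f - \<lambda> p'\<close>, where \<open>f = - d/dX\<close>. The computation that this is a
  representation uses only that multiplication by \<open>X\<close> and \<open>f\<close> satisfy \<open>[X, f] = 1\<close> and that \<open>\<lambda>\<close>
  commutes with both. So the scalar \<open>\<lambda>\<close> may be replaced by an operator
  (\<open>witt_module_density_action\<close>), and the task is to find operators \<open>X\<close> and \<open>\<lambda>\<close> on \<open>M\<close>.

  In the density model the \<open>\<ss>\<ll>(2)\<close> generators are
  \<open>h = - 2 L\<^sub>0 = 2 (\<lambda> - X f)\<close> and \<open>e = - L\<^sub>1 = 2 \<lambda> X - X\<^sup>2 f\<close>, and the Casimir operator is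
  \<open>(2 \<lambda> - 1)\<^sup>2\<close>. A square root \<open>s\<close> of \<open>c\<close> therefore dictates \<open>\<lambda> = (1 + s) / 2\<close>, and the formula for \<open>h\<close>
  dictates \<open>X = (\<lambda> - h / 2) f\<^sup>-\<^sup>1\<close>. With these choices \<open>[X, f] = 1\<close> is the relation \<open>[h, f] = -2 f\<close>,
  the formulas for \<open>f\<close> and \<open>h\<close> hold by construction, and the one for \<open>e\<close> can be checked after
  applying the injective operator \<open>f\<close>, because \<open>4 f e = c - (h + 1)\<^sup>2\<close>. Since \<open>s\<close>
  commutes with \<open>f\<close>, \<open>X\<close> and \<open>\<lambda>\<close>, so does \<open>c = s\<^sup>2\<close>, hence \<open>c\<close> is central.

  The hypothesis on \<open>\<tau>\<close> makes \<open>f\<close> invertible (\<open>f_bijective\<close>): on \<open>M\<^sub>\<mu>\<close> the operators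
  \<open>4 f e = c - (\<mu> + 1)\<^sup>2\<close> and \<open>4 e f = c - (\<mu> - 1)\<^sup>2\<close> are nilpotent perturbations of the nonzero scalars
  \<open>\<tau> - (\<mu> + 1)\<^sup>2\<close> and \<open>\<tau> - (\<mu> - 1)\<^sup>2\<close>.
\<close>

section \<open>Tensor densities with an operator as weight\<close>

text \<open>The operator \<open>d\<close> stands for \<open>- d/dX\<close>, the image of \<open>L\<^bsub>-1\<^esub>\<close>, which is why the commutation
  relation reads \<open>[x, d] = 1\<close>; \<open>lam\<close> is the density weight.\<close>

locale density_operators = vector_space scale
  for scale :: "complex \<Rightarrow> 'v::ab_group_add \<Rightarrow> 'v" +
  fixes x d lam :: "'v \<Rightarrow> 'v"
  assumes x_linear: "Vector_Spaces.linear scale scale x"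
    and d_linear: "Vector_Spaces.linear scale scale d"
    and lam_linear: "Vector_Spaces.linear scale scale lam"
    and canonical_commutation: "x (d v) = d (x v) + v"
    and lam_x: "lam (x v) = x (lam v)"
    and lam_d: "lam (d v) = d (lam v)"
begin

lemmas x_simps =
  module_hom.add[OF Vector_Spaces.linear.axioms(3)[OF x_linear]]
  module_hom.diff[OF Vector_Spaces.linear.axioms(3)[OF x_linear]]
  module_hom.scale[OF Vector_Spaces.linear.axioms(3)[OF x_linear]]
  module_hom.zero[OF Vector_Spaces.linear.axioms(3)[OF x_linear]]

lemmas d_simps =
  module_hom.add[OF Vector_Spaces.linear.axioms(3)[OF d_linear]]
  module_hom.diff[OF Vector_Spaces.linear.axioms(3)[OF d_linear]]
  module_hom.scale[OF Vector_Spaces.linear.axioms(3)[OF d_linear]]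
  module_hom.zero[OF Vector_Spaces.linear.axioms(3)[OF d_linear]]

lemmas lam_simps =
  module_hom.add[OF Vector_Spaces.linear.axioms(3)[OF lam_linear]]
  module_hom.diff[OF Vector_Spaces.linear.axioms(3)[OF lam_linear]]
  module_hom.scale[OF Vector_Spaces.linear.axioms(3)[OF lam_linear]]
  module_hom.zero[OF Vector_Spaces.linear.axioms(3)[OF lam_linear]]

definition poly_at_x :: "complex poly \<Rightarrow> 'v \<Rightarrow> 'v" where
  "poly_at_x p = fold_coeffs (\<lambda>a q v. scale a v + x (q v)) p (\<lambda>v. 0)"

lemma poly_at_x_0: "poly_at_x 0 v = 0"
  by (simp add: poly_at_x_def)

lemma poly_at_x_pCons: "poly_at_x (pCons a p) v = scale a v + x (poly_at_x p v)"
  by (simp add: poly_at_x_def fold_coeffs_def cCons_def x_simps)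

lemmas poly_at_x_rec = poly_at_x_0 poly_at_x_pCons

lemma poly_at_x_add: "poly_at_x (p + q) v = poly_at_x p v + poly_at_x q v"
  by (induction p q rule: poly_induct2)
    (simp_all add: poly_at_x_rec x_simps scale_left_distrib algebra_simps)

lemma poly_at_x_smult: "poly_at_x (smult a p) v = scale a (poly_at_x p v)"
  by (induction p) (simp_all add: poly_at_x_rec x_simps scale_right_distrib)

lemma poly_at_x_diff: "poly_at_x (p - q) v = poly_at_x p v - poly_at_x q v"
  using poly_at_x_add[of "p - q" q v] by simp

lemma poly_at_x_vec:
  "poly_at_x p (u + v) = poly_at_x p u + poly_at_x p v"
  "poly_at_x p (scale a v) = scale a (poly_at_x p v)"
  by (induction p)
    (simp_all add: poly_at_x_rec x_simps scale_right_distrib algebra_simps scale_left_commute)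

lemma poly_at_x_vec_diff: "poly_at_x p (u - v) = poly_at_x p u - poly_at_x p v"
  using poly_at_x_vec(1)[of p "u - v" v] by simp

lemma poly_at_x_mult: "poly_at_x (p * q) v = poly_at_x p (poly_at_x q v)"
  by (induction p) (simp_all add: poly_at_x_rec poly_at_x_add poly_at_x_smult)

text \<open>Needed both for the density weight and, in the end, for the square root of the Casimir
  operator.\<close>

lemma poly_at_x_commute:
  assumes "Vector_Spaces.linear scale scale t" and "\<And>v. t (x v) = x (t v)"
  shows "t (poly_at_x p v) = poly_at_x p (t v)"
proof -
  note lin = Vector_Spaces.linear.axioms(3)[OF assms(1)]
  show ?thesis
    by (induction p)
      (simp_all add: poly_at_x_rec assms(2) module_hom.add[OF lin] module_hom.scale[OF lin]
        module_hom.zero[OF lin])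
qed

text \<open>The Leibniz rule for \<open>d = - d/dX\<close>.\<close>

lemma d_poly_at_x: "d (poly_at_x p v) = poly_at_x p (d v) - poly_at_x (pderiv p) v"
proof (induction p)
  case 0
  show ?case by (simp add: poly_at_x_rec d_simps)
next
  case (pCons a p)
  have "d (x u) = x (d u) - u" for u
    using canonical_commutation[of u] by simp
  then show ?case
    by (simp add: poly_at_x_rec d_simps x_simps pderiv_pCons poly_at_x_add pCons.IH)
qed

definition density_action :: "complex poly \<Rightarrow> 'v \<Rightarrow> 'v" where
  "density_action p v = poly_at_x p (d v) - lam (poly_at_x (pderiv p) v)"

lemma density_action_add: "density_action (p + q) v = density_action p v + density_action q v"
  by (simp add: density_action_def pderiv_add poly_at_x_add lam_simps)

lemma density_action_smult: "density_action (smult a p) v = scale a (density_action p v)"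
  by (simp add: density_action_def pderiv_smult poly_at_x_smult lam_simps scale_right_diff_distrib)

lemma density_action_vec:
  "density_action p (u + v) = density_action p u + density_action p v"
  "density_action p (scale a v) = scale a (density_action p v)"
  by (simp_all add: density_action_def d_simps lam_simps poly_at_x_vec scale_right_diff_distrib)

text \<open>By the Leibniz rule, the terms with \<open>d\<^sup>2\<close>, with \<open>\<lambda>\<^sup>2\<close> and with \<open>\<lambda> d\<close> are symmetric in \<open>p\<close> and
  \<open>q\<close> and cancel; what remains is
  \<open>(p' q - p q') d - \<lambda> (p'' q - p q'')\<close>, the action of \<open>p' q - p q'\<close>.\<close>

lemma density_action_bracket:
  "density_action (witt_bracket p q) v
     = density_action p (density_action q v) - density_action q (density_action p v)"
proof -
  note lam_poly = poly_at_x_commute[OF lam_linear lam_x]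
  show ?thesis
    unfolding density_action_def witt_bracket_def
    by (simp add: poly_at_x_diff poly_at_x_add poly_at_x_mult[symmetric] poly_at_x_vec
        poly_at_x_vec_diff d_simps lam_simps d_poly_at_x pderiv_diff pderiv_mult lam_poly lam_d
        algebra_simps)
qed

theorem witt_module_density_action: "witt_module scale density_action"
proof unfold_locales
qed (simp_all add: density_action_add density_action_smult density_action_vec
    density_action_bracket)

lemma density_action_commute:
  assumes "Vector_Spaces.linear scale scale t"
    and "\<And>v. t (x v) = x (t v)" "\<And>v. t (d v) = d (t v)" "\<And>v. t (lam v) = lam (t v)"
  shows "t (density_action p v) = density_action p (t v)"
  using assms(3,4)
  by (simp add: density_action_def poly_at_x_commute[OF assms(1,2)]
      module_hom.diff[OF Vector_Spaces.linear.axioms(3)[OF assms(1)]])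

lemma density_action_L:
  "density_action (witt_L (-1)) v = d v"
  "density_action (witt_L 0) v = x (d v) - lam v"
  "density_action (witt_L 1) v = x (x (d v)) - scale 2 (lam (x v))"
proof -
  have "witt_L (-1) = [:1:]" "witt_L 0 = [:0, 1:]" "witt_L 1 = [:0, 0, 1:]"
    by (simp_all add: witt_L_def monom_0 monom_Suc numeral_2_eq_2)
  then show
    "density_action (witt_L (-1)) v = d v"
    "density_action (witt_L 0) v = x (d v) - lam v"
    "density_action (witt_L 1) v = x (x (d v)) - scale 2 (lam (x v))"
    by (simp_all add: density_action_def poly_at_x_rec pderiv_pCons x_simps lam_simps)
qed

end

section \<open>Nilpotent perturbations of scalars\<close>

lemma nilpotent_eigenvalue_zero:
  fixes scale :: "complex \<Rightarrow> 'v::ab_group_add \<Rightarrow> 'v"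
  assumes "Vector_Spaces.linear scale scale N"
    and "(N ^^ n) v = 0" and "N v = scale b v" and "b \<noteq> 0"
  shows "v = 0"
proof -
  interpret N: Vector_Spaces.linear scale scale N by fact
  have "(N ^^ m) v = scale (b ^ m) v" for m
    by (induction m) (simp_all add: assms(3) N.scale mult.commute)
  then show ?thesis
    using assms(2,4) by simp
qed

text \<open>By induction on \<open>n\<close>: if \<open>u\<close> solves the equation with right-hand side \<open>N v\<close>, then \<open>(v - u) / a\<close>
  solves it for \<open>v\<close>.\<close>

lemma nilpotent_plus_scalar_surj:
  fixes scale :: "complex \<Rightarrow> 'v::ab_group_add \<Rightarrow> 'v"
  assumes "Vector_Spaces.linear scale scale N" and "module.subspace scale S"
    and N_S: "\<And>u. u \<in> S \<Longrightarrow> N u \<in> S"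
    and "v \<in> S" and "(N ^^ n) v = 0" and a: "a \<noteq> 0"
  shows "\<exists>w\<in>S. N w + scale a w = v"
proof -
  interpret N: Vector_Spaces.linear scale scale N by fact
  note S = N.vs1.subspace_0 N.vs1.subspace_diff N.vs1.subspace_scale
  from assms(4,5) show ?thesis
  proof (induction n arbitrary: v)
    case 0
    then show ?case
      using assms(2) by (auto simp: N.zero intro!: bexI[of _ 0] S)
  next
    case (Suc n)
    then obtain u where u: "u \<in> S" "N u + scale a u = N v"
      using N_S by (auto simp: funpow_Suc_right simp del: funpow.simps)
    have "N (scale (1 / a) (v - u)) + scale a (scale (1 / a) (v - u))
        = scale (1 / a) (N v - N u - scale a u) + v"
      using a by (simp add: N.scale N.diff N.vs1.scale_right_diff_distrib algebra_simps)
    also have "N v - N u - scale a u = 0"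
      by (simp flip: u(2))
    finally show ?case
      using u(1) Suc.prems(1) assms(2) by (intro bexI[of _ "scale (1 / a) (v - u)"] S) auto
  qed
qed

section \<open>Invertibility of \<open>f\<close>\<close>

locale sl2_mod = lie_module mat_scale sl2 commutator scaleV act
  for scaleV :: "complex \<Rightarrow> 'v::ab_group_add \<Rightarrow> 'v" and act :: "cmat2 \<Rightarrow> 'v \<Rightarrow> 'v"
begin

abbreviation "e \<equiv> act sl2_e"
abbreviation "f \<equiv> act sl2_f"
abbreviation "h \<equiv> act sl2_h"
abbreviation "c \<equiv> casimir scaleV act"

sublocale e: Vector_Spaces.linear scaleV scaleV e by (rule act_linear[OF sl2_mem(1)])
sublocale f: Vector_Spaces.linear scaleV scaleV f by (rule act_linear[OF sl2_mem(2)])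
sublocale h: Vector_Spaces.linear scaleV scaleV h by (rule act_linear[OF sl2_mem(3)])

lemma ef: "e (f v) = f (e v) + h v"
  using act_bracket[OF sl2_mem(1,2), of v] by (simp add: sl2_brackets)

lemma he: "h (e v) = e (h v) + scaleV 2 (e v)"
  using act_bracket[OF sl2_mem(3,1), of v] by (simp add: sl2_brackets act_scale sl2_mem algebra_simps)

lemma hf: "h (f v) = f (h v) - scaleV 2 (f v)"
  using act_bracket[OF sl2_mem(3,2), of v]
  unfolding sl2_brackets act_scale[OF sl2_mem(2)] by (simp add: algebra_simps)

lemma casimir_fe: "c v = h (h v) + scaleV 2 (h v) + v + scaleV 4 (f (e v))"
  using V.scale_left_distrib[of 1 1 "h v"] by (simp add: casimir_def h.add algebra_simps)

lemma casimir_ef: "c v = h (h v) - scaleV 2 (h v) + v + scaleV 4 (e (f v))"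
  using V.scale_left_distrib[of 2 2 "h v"]
  by (simp add: casimir_fe ef V.scale_right_distrib algebra_simps)

lemma casimir_linear: "Vector_Spaces.linear scaleV scaleV c"
  by unfold_locales
    (simp_all add: casimir_fe e.add f.add h.add e.scale f.scale h.scale V.scale_right_distrib
      algebra_simps)

lemma act_coordinates:
  assumes "A \<in> sl2"
  shows "act A v = scaleV (A $ 1 $ 2) (e v) + scaleV (A $ 2 $ 1) (f v) + scaleV (A $ 1 $ 1) (h v)"
proof -
  have "mat_scale a A \<in> sl2" if "A \<in> sl2" for a A
    using subspace_carrier that by (rule mat_scale.subspace_scale)
  moreover have "A + B \<in> sl2" if "A \<in> sl2" "B \<in> sl2" for A B
    using subspace_carrier that by (rule mat_scale.subspace_add)
  ultimately show ?thesis
    by (subst sl2_coordinates[OF assms]) (simp add: act_add act_scale sl2_mem)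
qed

lemma weight_f: "v \<in> weight_space scaleV act \<mu> \<Longrightarrow> f v \<in> weight_space scaleV act (\<mu> - 2)"
  by (simp add: weight_space_def hf f.scale V.scale_left_diff_distrib)

lemma casimir_weight_fe:
  "v \<in> weight_space scaleV act \<mu> \<Longrightarrow> c v = scaleV ((\<mu> + 1)\<^sup>2) v + scaleV 4 (f (e v))"
  by (simp add: casimir_fe weight_space_def h.scale power2_eq_square V.scale_left_distrib algebra_simps)

lemma casimir_weight_ef:
  "v \<in> weight_space scaleV act \<mu> \<Longrightarrow> c v = scaleV ((\<mu> - 1)\<^sup>2) v + scaleV 4 (e (f v))"
  by (simp add: casimir_ef weight_space_def h.scale power2_eq_square V.scale_left_distrib
      V.scale_left_diff_distrib algebra_simps)

lemma subspace_weight_space: "V.subspace (weight_space scaleV act \<mu>)"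
  by (auto simp: V.subspace_def weight_space_def h.zero h.add h.scale V.scale_right_distrib mult.commute)

lemma casimir_weight_space:
  "v \<in> weight_space scaleV act \<mu> \<Longrightarrow> c v \<in> weight_space scaleV act \<mu>"
  by (simp add: weight_space_def casimir_fe h.add h.scale h.diff hf he e.scale f.scale f.add
      V.scale_right_distrib algebra_simps)

text \<open>Because \<open>f\<close> maps \<open>M\<^sub>\<mu>\<close> to \<open>M\<^bsub>\<mu>-2\<^esub>\<close>, it suffices to show that it is injective on each weight
  space and that each weight vector lies in its range. On \<open>M\<^sub>\<mu>\<close> one uses
  \<open>4 e f = c - (\<mu> - 1)\<^sup>2\<close> for the first and \<open>4 f e = c - (\<mu> + 1)\<^sup>2\<close> for the second. The first needs
  \<open>\<tau> \<noteq> (\<mu> - 1)\<^sup>2\<close>, which is the hypothesis on \<open>\<tau>\<close> at the weight \<open>\<mu> - 2\<close>; this is where it matters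
  that \<open>\<xi>\<close> is a whole class modulo \<open>2 \<int>\<close>.\<close>

theorem f_bijective:
  assumes \<xi>: "\<xi> \<in> UNIV // cong_mod_2Z"
    and \<tau>: "\<forall>\<mu>\<in>\<xi>. \<tau> \<noteq> (\<mu> + 1)\<^sup>2"
    and M: "object_M_bar \<xi> \<tau> scaleV act"
  shows "bij f"
proof -
  let ?M = "weight_space scaleV act"
  let ?N = "\<lambda>w. c w - scaleV \<tau> w"
  interpret c: Vector_Spaces.linear scaleV scaleV c by (rule casimir_linear)
  have N_linear: "Vector_Spaces.linear scaleV scaleV ?N"
    by unfold_locales
      (simp_all add: c.add c.scale V.scale_right_distrib V.scale_right_diff_distrib mult.commute)
  have decomp: "\<exists>!c. finite {\<mu>. c \<mu> \<noteq> 0} \<and> (\<forall>\<mu>. c \<mu> \<in> ?M \<mu>) \<and> v = (\<Sum>\<mu> | c \<mu> \<noteq> 0. c \<mu>)" for v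
    using M by (simp add: object_M_bar_def weight_module_def)
  have in_\<xi>: "\<mu> \<in> \<xi>" if "v \<in> ?M \<mu>" "v \<noteq> 0" for \<mu> v
    using M that by (auto simp: object_M_bar_def supp_def)
  have nilp: "\<exists>n. (?N ^^ n) v = 0" if "v \<in> ?M \<mu>" "v \<noteq> 0" for \<mu> v
    using M that in_\<xi>[OF that] unfolding object_M_bar_def by blast
  have shift: "\<mu> - 2 \<in> \<xi>" if \<mu>: "\<mu> \<in> \<xi>" for \<mu>
  proof -
    from \<xi> obtain z where z: "\<xi> = cong_mod_2Z `` {z}"
      by (auto elim: quotientE)
    from \<mu> obtain n :: int where n: "z - \<mu> = 2 * of_int n"
      unfolding z cong_mod_2Z_def by auto
    have "z - (\<mu> - 2) = 2 * of_int (n + 1)"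
      using n by (simp add: algebra_simps)
    then show ?thesis
      unfolding z cong_mod_2Z_def by blast
  qed
  have f_weight_inj: "v = 0" if v: "v \<in> ?M \<mu>" "f v = 0" for \<mu> v
  proof (rule ccontr)
    assume "v \<noteq> 0"
    with v(1) obtain n where n: "(?N ^^ n) v = 0"
      using nilp by blast
    have "c v = scaleV ((\<mu> - 1)\<^sup>2) v"
      using casimir_weight_ef[OF v(1)] v(2) by (simp add: e.zero)
    then have Nv: "?N v = scaleV ((\<mu> - 1)\<^sup>2 - \<tau>) v"
      by (simp add: V.scale_left_diff_distrib)
    have "\<mu> - 2 \<in> \<xi>"
      using shift in_\<xi> v(1) \<open>v \<noteq> 0\<close> by blast
    with \<tau> have "(\<mu> - 1)\<^sup>2 - \<tau> \<noteq> 0"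
      by (force simp: algebra_simps)
    with nilpotent_eigenvalue_zero[OF N_linear n Nv] \<open>v \<noteq> 0\<close> show False
      by blast
  qed
  have f_weight_surj: "v \<in> range f" if v: "v \<in> ?M \<mu>" for \<mu> v
  proof (cases "v = 0")
    case True
    then show ?thesis
      using f.zero by (metis rangeI)
  next
    case False
    with v obtain n where n: "(?N ^^ n) v = 0"
      using nilp by blast
    have "?N u \<in> ?M \<mu>" if "u \<in> ?M \<mu>" for u
      using casimir_weight_space that subspace_weight_space
      by (intro V.subspace_diff V.subspace_scale)
    moreover have "\<tau> - (\<mu> + 1)\<^sup>2 \<noteq> 0"
      using \<tau> in_\<xi>[OF v False] by simp
    ultimately obtain w where w: "w \<in> ?M \<mu>" "?N w + scaleV (\<tau> - (\<mu> + 1)\<^sup>2) w = v"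
      using nilpotent_plus_scalar_surj[OF N_linear subspace_weight_space _ v n] by blast
    then have "v = f (scaleV 4 (e w))"
      by (simp add: casimir_weight_fe f.scale V.scale_left_diff_distrib)
    then show ?thesis by blast
  qed
  have "v = 0" if fv: "f v = 0" for v
  proof -
    from decomp[of v] obtain u where
      u: "finite {\<mu>. u \<mu> \<noteq> 0}" "\<forall>\<mu>. u \<mu> \<in> ?M \<mu>" "v = (\<Sum>\<mu> | u \<mu> \<noteq> 0. u \<mu>)"
      by blast
    (* The shifted family decomposes f v = 0 into weight vectors, as the zero family does. *)
    let ?d = "\<lambda>\<mu>. f (u (\<mu> + 2))"
    have d_supp: "{\<mu>. ?d \<mu> \<noteq> 0} = (\<lambda>\<mu>. \<mu> - 2) ` {\<mu>. u \<mu> \<noteq> 0}"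
    proof -
      have "?d \<mu> \<noteq> 0 \<longleftrightarrow> u (\<mu> + 2) \<noteq> 0" for \<mu>
        using f_weight_inj u(2) f.zero by metis
      then show ?thesis
        by (force simp: image_iff)
    qed
    have "(\<Sum>\<mu> | ?d \<mu> \<noteq> 0. ?d \<mu>) = (\<Sum>\<mu> | u \<mu> \<noteq> 0. f (u \<mu>))"
      unfolding d_supp by (subst sum.reindex) (auto simp: inj_on_def)
    also have "\<dots> = f v"
      by (simp add: u(3) f.sum)
    finally have d_sum: "0 = (\<Sum>\<mu> | ?d \<mu> \<noteq> 0. ?d \<mu>)"
      using fv by simp
    have d_weight: "?d \<mu> \<in> ?M \<mu>" for \<mu>
      using weight_f[of "u (\<mu> + 2)" "\<mu> + 2"] u(2) by simp
    obtain z where z: "\<And>y. finite {\<mu>. y \<mu> \<noteq> 0} \<Longrightarrow> (\<And>\<mu>. y \<mu> \<in> ?M \<mu>) \<Longrightarrow>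
        0 = (\<Sum>\<mu> | y \<mu> \<noteq> 0. y \<mu>) \<Longrightarrow> y = z"
      using decomp[of 0] by (elim ex1E) (rule that, blast)
    have "?d = z"
      using u(1) d_weight d_sum by (intro z) (simp_all add: d_supp)
    moreover have "(\<lambda>\<mu>. 0) = z"
      by (rule z) (simp_all add: V.subspace_0[OF subspace_weight_space])
    ultimately have d_zero: "?d \<mu> = 0" for \<mu>
      by (metis (no_types))
    have "u \<mu> = 0" for \<mu>
      using f_weight_inj[of "u \<mu>" \<mu>] u(2) d_zero[of "\<mu> - 2"] by simp
    then show "v = 0"
      by (simp add: u(3))
  qed
  then have "inj f"
    by (intro injI) (metis f.diff right_minus_eq)
  moreover have "v \<in> range f" for v
  proof -
    from decomp[of v] obtain u where "\<forall>\<mu>. u \<mu> \<in> ?M \<mu>" "v = (\<Sum>\<mu> | u \<mu> \<noteq> 0. u \<mu>)"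
      by blast
    moreover have "V.subspace (range f)"
      by (intro f.subspace_image V.subspace_UNIV)
    ultimately show ?thesis
      using f_weight_surj by (auto intro!: V.subspace_sum)
  qed
  ultimately show ?thesis
    by (auto simp: bij_def)
qed

end

section \<open>The density structure attached to a square root of the Casimir operator\<close>

locale sl2_mod_casimir_root = sl2_mod scaleV act
  for scaleV :: "complex \<Rightarrow> 'v::ab_group_add \<Rightarrow> 'v" and act :: "cmat2 \<Rightarrow> 'v \<Rightarrow> 'v" +
  fixes s :: "'v \<Rightarrow> 'v"
  assumes f_bij: "bij f"
    and s_endomorphism: "sl2_endomorphism scaleV act s"
    and s_square: "s (s v) = c v"
begin

sublocale s: Vector_Spaces.linear scaleV scaleV s
  using s_endomorphism by (simp add: sl2_endomorphism_def)

lemma s_act: "s (e v) = e (s v)" "s (f v) = f (s v)" "s (h v) = h (s v)"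
  using s_endomorphism by (simp_all add: sl2_endomorphism_def sl2_mem)

abbreviation "f_inv \<equiv> inv f"

lemma f_f_inv: "f (f_inv v) = v"
  using f_bij by (simp add: bij_is_surj surj_f_inv_f)

lemma f_inv_f: "f_inv (f v) = v"
  using f_bij by (simp add: bij_is_inj)

lemma f_eqI: "f u = f v \<Longrightarrow> u = v"
  using f_bij by (metis bij_is_inj injD)

text \<open>Solving \<open>(2 \<lambda> - 1)\<^sup>2 = c = s\<^sup>2\<close> for the density weight.\<close>

definition density_weight :: "'v \<Rightarrow> 'v" where
  "density_weight v = scaleV (1/2) (v + s v)"

text \<open>Multiplication by the coordinate of the line, obtained by solving
  \<open>h = - 2 L\<^sub>0 = 2 (\<lambda> - X f)\<close> for \<open>X\<close>.\<close>

definition coordinate :: "'v \<Rightarrow> 'v" where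
  "coordinate v = density_weight (f_inv v) - scaleV (1/2) (h (f_inv v))"

lemma f_inv_linear: "f_inv (u + v) = f_inv u + f_inv v" "f_inv (scaleV a v) = scaleV a (f_inv v)"
  by (rule f_eqI, simp add: f_f_inv f.add f.scale)+

lemma s_f_inv: "s (f_inv v) = f_inv (s v)"
  by (rule f_eqI) (simp add: f_f_inv flip: s_act)

lemma density_weight_linear: "Vector_Spaces.linear scaleV scaleV density_weight"
  by unfold_locales
    (simp_all add: density_weight_def s.add s.scale V.scale_right_distrib algebra_simps)

sublocale density_weight: Vector_Spaces.linear scaleV scaleV density_weight
  by (rule density_weight_linear)

lemma coordinate_linear: "Vector_Spaces.linear scaleV scaleV coordinate"
proof unfold_locales
  show "coordinate (u + v) = coordinate u + coordinate v" for u v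
    by (simp add: coordinate_def f_inv_linear density_weight.add h.add V.scale_right_distrib)
  show "coordinate (scaleV a v) = scaleV a (coordinate v)" for a v
    by (simp add: coordinate_def f_inv_linear density_weight.scale h.scale V.scale_right_diff_distrib)
qed

lemma coordinate_f: "coordinate (f v) = density_weight v - scaleV (1/2) (h v)"
  by (simp add: coordinate_def f_inv_f)

lemma s_coordinate: "s (coordinate v) = coordinate (s v)"
  by (simp add: coordinate_def density_weight_def s.add s.diff s.scale s_act s_f_inv)

lemma coordinate_commutation: "coordinate (f v) = f (coordinate v) + v"
proof -
  have "f (h (f_inv v)) = h v + scaleV 2 v"
    using hf[of "f_inv v"] by (simp add: f_f_inv)
  then have "f (coordinate v) = density_weight v - scaleV (1/2) (h v) - v"
    by (simp add: coordinate_def density_weight_def f.diff f.add f.scale f_f_inv V.scale_right_distrib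
        flip: s_act(2))
  then show ?thesis
    by (simp add: coordinate_f)
qed

sublocale density_operators scaleV coordinate f density_weight
proof (intro density_operators.intro density_operators_axioms.intro)
  show "density_weight (coordinate v) = coordinate (density_weight v)" for v
    using module_hom.add[OF Vector_Spaces.linear.axioms(3)[OF coordinate_linear]]
      module_hom.scale[OF Vector_Spaces.linear.axioms(3)[OF coordinate_linear]]
    by (simp add: density_weight_def s_coordinate)
  show "density_weight (f v) = f (density_weight v)" for v
    by (simp add: density_weight_def s_act f.add f.scale)
qed (fact V.vector_space_axioms coordinate_linear f.linear_axioms density_weight_linear
    coordinate_commutation)+

text \<open>Both sides are compared after applying \<open>f\<close>. With \<open>k = X f = \<lambda> - h / 2\<close> and \<open>f X = k - 1\<close>, the
  left-hand side becomes \<open>2 \<lambda> (k - 1) - (k\<^sup>2 - k)\<close>, and four times this is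
  \<open>(2 \<lambda> - 1)\<^sup>2 - (2 \<lambda> - 2 k + 1)\<^sup>2 = s\<^sup>2 - (h + 1)\<^sup>2 = 4 f e\<close>.\<close>

lemma density_action_e: "density_action (- witt_L 1) v = e v"
proof (rule f_eqI)
  have two: "scaleV 2 w = w + w" and four: "scaleV 4 w = w + w + w + w" for w
    using V.scale_left_distrib[of 1 1 w] V.scale_left_distrib[of 2 2 w] by (simp_all add: algebra_simps)
  (* u is k v in the notation above. *)
  define u where "u = density_weight v - scaleV (1/2) (h v)"
  have f_x: "f (coordinate w) = density_weight w - scaleV (1/2) (h w) - w" for w
    using canonical_commutation[of w] by (simp add: coordinate_f)
  have "density_action (- witt_L 1) v = scaleV 2 (density_weight (coordinate v)) - coordinate u"
    using density_action_smult[of "-1" "witt_L 1" v]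
    by (simp add: density_action_L coordinate_f u_def)
  then have f_action: "f (density_action (- witt_L 1) v)
      = scaleV 2 (density_weight (u - v)) - (density_weight u - scaleV (1/2) (h u) - u)"
    by (simp add: f.diff f.scale f_x u_def flip: lam_d)
  have "scaleV 4 (f (density_action (- witt_L 1) v))
      = s (s v) - (h (h v) + scaleV 2 (h v) + v)"
    unfolding f_action u_def density_weight_def
    by (simp add: V.scale_right_distrib V.scale_right_diff_distrib
        s.add s.diff s.scale h.add h.diff h.scale s_act)
      (simp add: two four algebra_simps)
  also have "\<dots> = scaleV 4 (f (e v))"
    by (simp add: s_square casimir_fe)
  finally show "f (density_action (- witt_L 1) v) = f (e v)"
    by simp
qed

lemma density_action_h: "density_action (smult (-2) (witt_L 0)) v = h v"
  by (subst density_action_smult) (simp add: density_action_L coordinate_f)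

theorem compatible_density_action: "compatible act density_action"
  unfolding compatible_def
proof (intro ballI allI)
  fix A v
  assume "A \<in> sl2"
  have "density_action (sl2_to_witt A) v = scaleV (A $ 2 $ 1) (f v)
      + scaleV (A $ 1 $ 1) (h v) + scaleV (A $ 1 $ 2) (e v)"
    by (simp only: sl2_to_witt_def density_action_add density_action_smult[of "A $ i $ j" for i j]
        density_action_e density_action_h density_action_L)
  then show "density_action (sl2_to_witt A) v = act A v"
    by (simp add: act_coordinates[OF \<open>A \<in> sl2\<close>])
qed

theorem casimir_density_action: "c (density_action p v) = density_action p (c v)"
proof -
  have "s (density_action p v) = density_action p (s v)" for v
    by (intro density_action_commute s.linear_axioms)
      (simp_all add: s_coordinate s_act density_weight_def s.add s.scale)
  then show ?thesis
    by (simp flip: s_square)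
qed

end

section \<open>Existence of the compatible structure\<close>

theorem proposition4p4:
  fixes \<xi> :: "complex set" and \<tau> :: complex
    and scaleV :: "complex \<Rightarrow> 'v::ab_group_add \<Rightarrow> 'v"
    and act :: "cmat2 \<Rightarrow> 'v \<Rightarrow> 'v"
    and s :: "'v \<Rightarrow> 'v"
  assumes "\<xi> \<in> UNIV // cong_mod_2Z"
    and "\<forall>\<mu>\<in>\<xi>. \<tau> \<noteq> (\<mu> + 1)\<^sup>2"
    and "object_M_bar \<xi> \<tau> scaleV act"
    and "sl2_endomorphism scaleV act s"
    and "\<forall>v. s (s v) = casimir scaleV act v"
  shows "\<exists>W. witt_module scaleV W \<and> compatible act W \<and>
           (\<forall>i\<ge>-1. \<forall>v. casimir scaleV act (W (witt_L i) v) = W (witt_L i) (casimir scaleV act v))"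
proof -
  interpret sl2_mod scaleV act
    using assms(3) by (simp add: object_M_bar_def weight_module_def sl2_mod_def)
  interpret sl2_mod_casimir_root scaleV act s
    using f_bijective[OF assms(1-3)] assms(4,5) by unfold_locales auto
  show ?thesis
    using witt_module_density_action compatible_density_action casimir_density_action by blast
qed

end
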